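(* The geometric consistency index $GCI$ does not satisfy the upper boundary axiom: it is not true that for every order $n\ge3$ there exists $K\in\mathbb{R}$ with $GCI(A)\le K$ for all reciprocal matrices $A\in M_R$ of order $n$. That is, there is an order $n\ge 3$ for which $GCI$ is not bounded from above on $M_R$.
   Context: $M_R$ is the set of all real $n\times n$ matrices $A=(a_{ij})$ with $a_{ij}>0$ for all $i,j$ and $a_{ij}=1/a_{ji}$ for all $i,j$ (reciprocal matrices). For $n\ge3$ and $A\in M_R$, $$GCI(A)=\frac{2}{(n-1)(n-2)}\sum_{i=1}^{n-1}\sum_{j=i+1}^{n}\ln^2\left(a_{ij}\frac{w_j}{w_i}\right),$$ where $w=(w_1,\dots,w_n)$ is the priority vector of $A$ given by the geometric mean method, $w_i=(\prod_{j=1}^n a_{ij})^{1/n}/\sum_{k=1}^n(\prod_{j=1}^n a_{kj})^{1/n}$. *)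

theory Defs
  imports Complex_Main "Jordan_Normal_Form.Matrix"
begin

text \<open>Matrix indices run from 0 to n - 1, following the matrix library.\<close>

definition reciprocal_mats :: "nat \<Rightarrow> real mat set" where
  "reciprocal_mats n = {A \<in> carrier_mat n n.
     \<forall>i<n. \<forall>j<n. A $$ (i, j) > 0 \<and> A $$ (i, j) = 1 / A $$ (j, i)}"

definition row_geometric_mean :: "real mat \<Rightarrow> nat \<Rightarrow> real" where
  "row_geometric_mean A i = root (dim_col A) (\<Prod>j<dim_col A. A $$ (i, j))"

definition gm_priority_vec :: "real mat \<Rightarrow> real vec" where
  "gm_priority_vec A =
     vec (dim_row A) (\<lambda>i. row_geometric_mean A i / (\<Sum>k<dim_row A. row_geometric_mean A k))"

definition GCI :: "real mat \<Rightarrow> real" where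
  "GCI A = (let n = dim_row A; w = gm_priority_vec A in
     2 / ((real n - 1) * (real n - 2)) *
     (\<Sum>i\<in>{0..<n - 1}. \<Sum>j\<in>{i + 1..<n}. (ln (A $$ (i, j) * (w $ j / w $ i)))\<^sup>2))"

text \<open>The bound may depend on the order of the matrices.\<close>

definition satisfies_upper_boundary_axiom :: "(real mat \<Rightarrow> real) \<Rightarrow> bool" where
  "satisfies_upper_boundary_axiom I \<longleftrightarrow>
     (\<forall>n\<ge>3. \<exists>K. \<forall>A\<in>reciprocal_mats n. I A \<le> K)"

end

theory Submission
  imports Defs
begin

text \<open>The matrices of order 3 with entries \<open>exp t\<close> along the cycle \<open>0 \<rightarrow> 1 \<rightarrow> 2 \<rightarrow> 0\<close> have all row
  products equal to 1, so the priority vector is uniform and the index is \<open>3 t\<^sup>2\<close>, which is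
  unbounded in \<open>t\<close>.\<close>

definition cyclic_mat :: "real \<Rightarrow> real mat" where
  "cyclic_mat t = mat 3 3 (\<lambda>(i, j).
     if j = (i + 1) mod 3 then exp t else if i = (j + 1) mod 3 then exp (- t) else 1)"

lemma cyclic_mat_dim [simp]: "dim_row (cyclic_mat t) = 3" "dim_col (cyclic_mat t) = 3"
  by (simp_all add: cyclic_mat_def)

lemma cyclic_mat_entries [simp]:
  "cyclic_mat t $$ (0, 0) = 1" "cyclic_mat t $$ (0, 1) = exp t" "cyclic_mat t $$ (0, 2) = exp (- t)"
  "cyclic_mat t $$ (1, 0) = exp (- t)" "cyclic_mat t $$ (1, 1) = 1" "cyclic_mat t $$ (1, 2) = exp t"
  "cyclic_mat t $$ (2, 0) = exp t" "cyclic_mat t $$ (2, 1) = exp (- t)" "cyclic_mat t $$ (2, 2) = 1"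
  by (simp_all add: cyclic_mat_def)

lemma less_3_cases: "i < 3 \<longleftrightarrow> i = 0 \<or> i = 1 \<or> i = (2::nat)"
  by linarith

lemma cyclic_mat_reciprocal: "cyclic_mat t \<in> reciprocal_mats 3"
proof -
  have "cyclic_mat t $$ (i, j) > 0 \<and> cyclic_mat t $$ (i, j) = 1 / cyclic_mat t $$ (j, i)"
    if "i < 3" "j < 3" for i j
    using that unfolding less_3_cases
    by (elim disjE; simp only: cyclic_mat_entries; simp add: exp_minus divide_inverse)
  moreover have "cyclic_mat t \<in> carrier_mat 3 3" by (intro carrier_matI cyclic_mat_dim)
  ultimately show ?thesis unfolding reciprocal_mats_def by blast
qed

text \<open>Every row contains \<open>1\<close>, \<open>exp t\<close> and \<open>exp (- t)\<close>
  exactly once, in some order, so its product is 1.\<close>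

lemma row_geometric_mean_cyclic_mat:
  assumes "i < 3"
  shows "row_geometric_mean (cyclic_mat t) i = 1"
proof -
  have "{..<3} = {0, 1, 2::nat}" by auto
  then have prod: "(\<Prod>j<3. cyclic_mat t $$ (i, j)) =
      cyclic_mat t $$ (i, 0) * (cyclic_mat t $$ (i, 1) * cyclic_mat t $$ (i, 2))"
    by simp
  have "(\<Prod>j<3. cyclic_mat t $$ (i, j)) = 1"
    using assms unfolding prod less_3_cases
    by (elim disjE; simp only: cyclic_mat_entries; simp flip: exp_add)
  then show ?thesis
    by (simp add: row_geometric_mean_def)
qed

lemma gm_priority_vec_cyclic_mat: "gm_priority_vec (cyclic_mat t) = vec 3 (\<lambda>_. 1 / 3)"
  by (intro eq_vecI) (simp_all add: gm_priority_vec_def row_geometric_mean_cyclic_mat)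

text \<open>Equal weights make every ratio \<open>w $ j / w $ i\<close> equal to 1, and the
  normalising factor is 1 for order 3. The entries above the diagonal have logarithms
  \<open>t\<close>, \<open>- t\<close>, \<open>t\<close>, each contributing
  \<open>t\<^sup>2\<close>.\<close>

lemma GCI_cyclic_mat: "GCI (cyclic_mat t) = 3 * t\<^sup>2"
proof -
  have "{0..<3 - 1} = {0, 1::nat}" "{0 + 1..<3} = {1, 2::nat}" "{1 + 1..<3} = {2::nat}"
    by auto
  then have "(\<Sum>i\<in>{0..<3 - 1}. \<Sum>j\<in>{i + 1..<3}. f i j) = f 0 1 + f 0 2 + f 1 (2::nat)"
    for f :: "nat \<Rightarrow> nat \<Rightarrow> real"
    by (simp only: sum.insert sum.empty finite.intros) simp
  then show ?thesis
    unfolding GCI_def Let_def gm_priority_vec_cyclic_mat cyclic_mat_dim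
    by (simp only: cyclic_mat_entries) simp
qed

theorem proposition21:
  shows "\<not> satisfies_upper_boundary_axiom GCI"
proof
  assume "satisfies_upper_boundary_axiom GCI"
  \<comment> \<open>The axiom asks for a bound at every order from 3 on, so refuting it at order 3
    is enough.\<close>
  then obtain K where K: "\<forall>A\<in>reciprocal_mats 3. GCI A \<le> K"
    unfolding satisfies_upper_boundary_axiom_def by blast
  \<comment> \<open>The parameter \<open>t = sqrt (\<bar>K\<bar> + 1)\<close> makes the index
    \<open>3 * (\<bar>K\<bar> + 1)\<close>, which exceeds \<open>K\<close> whatever its
    sign.\<close>
  have "3 * (sqrt (\<bar>K\<bar> + 1))\<^sup>2 \<le> K"
    using K cyclic_mat_reciprocal GCI_cyclic_mat by metis
  then show False by simp
qed

end
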